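(* Consider the relay network with one source node $0$ and one relay node $1$, with arrival rates $\boldsymbol\lambda=(\lambda_0,\lambda_1)$, $\lambda_0,\lambda_1\ge0$, and ON-channel probabilities $\rho_0,\rho_1$ to the destination. Its achievable rate region $\Lambda^c$ is the following. If $\rho_1<0.5$, $$\Lambda^{c}=\left\{\boldsymbol\lambda:\ \lambda_1<\rho_1,\ \lambda_0+\lambda_1<\rho_0+\rho_1(1-\rho_0)\right\}.$$ If $\rho_1\ge 0.5$, $\Lambda^c$ is the set of $\boldsymbol\lambda$ satisfying one of the following: (i) $\lambda_1<(1-\rho_0)(2\rho_1-1)$ and $2\lambda_0+\lambda_1<1+\rho_0$; or (ii) $(1-\rho_0)(2\rho_1-1)\le\lambda_1<\rho_1$ and $\lambda_0+\lambda_1<\rho_0+(1-\rho_0)\rho_1$.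
   Context: **Network.** Time is slotted. Source node $0$ and relay node $1$ send unit-size packets to a common destination; at most one node transmits per slot, one packet per slot. The channel of node $i\in\{0,1\}$ to the destination has state $s_i(t)\in\{0,1\}$ (ON $=1$), independent across time and nodes, with $\Pr(s_i(t)=1)=\rho_i$; states are known at the start of each slot. The channel from node $0$ to node $1$ is always ON. Arrivals $A_i(t)$ to node $i$ are i.i.d. in time, independent across nodes, integer valued with $0\le A_i(t)\le A_{max}$, and mean $\lambda_i$. Node $i$ has a queue $Q_i(t)$ of its own packets and node $1$ has a second queue $Q_{01}(t)$ of packets received from node $0$ to be relayed to the destination. **Policies.** A policy chooses (causally) in each slot at most one transmission: node $0$ sends a packet from $Q_0$ to the destination (requires $s_0(t)=1$); node $0$ forwards a packet from $Q_0$ to node $1$, where it joins $Q_{01}$; or node $1$ sends a packet from $Q_1$ or from $Q_{01}$ to the destination (requires $s_1(t)=1$). Packets delivered to the destination leave the network. **Achievable rate region.** Queues are (strongly) stable if $\limsup_{T\to\infty}\frac1T\sum_{t=0}^{T-1}\mathbb E[Q_0(t)+Q_1(t)+Q_{01}(t)]<\infty$. A policy stabilizes $\boldsymbol\lambda$ if the queues are stable for all arrival processes $A_0(t),A_1(t)$ that are i.i.d. in time, independent across nodes, integer valued with $0\le A_i(t)\le A_{max}$, and have mean vector $\boldsymbol\lambda$. The achievable rate region is the set of $\boldsymbol\lambda\ge 0$ such that for some $\epsilon>0$ the vector $(\lambda_0+\epsilon,\lambda_1+\epsilon)$ is stabilized by some policy.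
   Formalization: The achievable rate region additionally requires λ_i+ε ≤ A_max (with A_max ≥ 1 an integer); otherwise no arrival process has the shifted mean, every policy stabilizes it vacuously, and every rate vector would be achievable. *)

theory Defs
  imports "HOL-Probability.Probability"
begin

text \<open>
  Backlogs count unit-size packets: \<open>queue0\<close> and \<open>queue1\<close> hold the packets originating at the
  source node 0 and at the relay node 1, and \<open>queue01\<close> (located at node 1) holds the packets of
  node 0 that are waiting to be relayed.
\<close>

datatype backlog = Backlog (queue0: nat) (queue1: nat) (queue01: nat)

datatype action = Idle | Send0 | Forward | Send1 | Send01

text \<open>Channel states and arrivals are pairs, node 0 first; \<open>True\<close> is ON.\<close>

type_synonym slot = "(bool \<times> bool) \<times> action \<times> (nat \<times> nat)"

fun permitted :: "backlog \<Rightarrow> bool \<times> bool \<Rightarrow> action set" where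
  "permitted q (s0, s1) =
     {Idle}
     \<union> {x. x = Send0 \<and> s0 \<and> queue0 q > 0}
     \<union> {x. x = Forward \<and> queue0 q > 0}
     \<union> {x. x = Send1 \<and> s1 \<and> queue1 q > 0}
     \<union> {x. x = Send01 \<and> s1 \<and> queue01 q > 0}"

text \<open>The subtractions below never truncate when the action is permitted.\<close>

fun transmit :: "action \<Rightarrow> backlog \<Rightarrow> backlog" where
  "transmit Idle q = q"
| "transmit Send0 (Backlog q0 q1 q01) = Backlog (q0 - 1) q1 q01"
| "transmit Forward (Backlog q0 q1 q01) = Backlog (q0 - 1) q1 (q01 + 1)"
| "transmit Send1 (Backlog q0 q1 q01) = Backlog q0 (q1 - 1) q01"
| "transmit Send01 (Backlog q0 q1 q01) = Backlog q0 q1 (q01 - 1)"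

fun arrive :: "nat \<times> nat \<Rightarrow> backlog \<Rightarrow> backlog" where
  "arrive (a0, a1) (Backlog q0 q1 q01) = Backlog (q0 + a0) (q1 + a1) q01"

text \<open>
  A history lists the past slots, the most recent one first. The network starts empty, and packets
  arriving during a slot can be transmitted from the next slot on.
\<close>

fun backlog_after :: "slot list \<Rightarrow> backlog" where
  "backlog_after [] = Backlog 0 0 0"
| "backlog_after ((s, x, a) # h) = arrive a (transmit x (backlog_after h))"

text \<open>
  A policy sees all past channel states, actions and arrivals together with the current channel
  states, and may randomize: it returns a distribution over actions. Deterministic policies return
  point masses.
\<close>

type_synonym policy = "slot list \<Rightarrow> bool \<times> bool \<Rightarrow> action pmf"

definition is_policy :: "policy \<Rightarrow> bool" where
  "is_policy \<pi> \<longleftrightarrow> (\<forall>h s. set_pmf (\<pi> h s) \<subseteq> permitted (backlog_after h) s)"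

text \<open>
  The law of the history of the first \<open>t\<close> slots. Channel states and arrivals are drawn afresh in
  every slot, independently of the past and of each other, so they are i.i.d. in time and
  independent across nodes. Such an arrival process is determined, in law, by its one-slot marginals
  \<open>\<alpha>0\<close> and \<open>\<alpha>1\<close>; quantifying over arrival processes therefore means quantifying over these.
\<close>

primrec history_pmf ::
  "real \<Rightarrow> real \<Rightarrow> nat pmf \<Rightarrow> nat pmf \<Rightarrow> policy \<Rightarrow> nat \<Rightarrow> slot list pmf" where
  "history_pmf \<rho>0 \<rho>1 \<alpha>0 \<alpha>1 \<pi> 0 = return_pmf []"
| "history_pmf \<rho>0 \<rho>1 \<alpha>0 \<alpha>1 \<pi> (Suc t) =
     do {
       h \<leftarrow> history_pmf \<rho>0 \<rho>1 \<alpha>0 \<alpha>1 \<pi> t;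
       s \<leftarrow> pair_pmf (bernoulli_pmf \<rho>0) (bernoulli_pmf \<rho>1);
       x \<leftarrow> \<pi> h s;
       a \<leftarrow> pair_pmf \<alpha>0 \<alpha>1;
       return_pmf ((s, x, a) # h)
     }"

definition expected_backlog ::
  "real \<Rightarrow> real \<Rightarrow> nat pmf \<Rightarrow> nat pmf \<Rightarrow> policy \<Rightarrow> nat \<Rightarrow> real" where
  "expected_backlog \<rho>0 \<rho>1 \<alpha>0 \<alpha>1 \<pi> t =
     measure_pmf.expectation (history_pmf \<rho>0 \<rho>1 \<alpha>0 \<alpha>1 \<pi> t)
       (\<lambda>h. real (queue0 (backlog_after h) + queue1 (backlog_after h) + queue01 (backlog_after h)))"

definition strongly_stable ::
  "real \<Rightarrow> real \<Rightarrow> nat pmf \<Rightarrow> nat pmf \<Rightarrow> policy \<Rightarrow> bool" where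
  "strongly_stable \<rho>0 \<rho>1 \<alpha>0 \<alpha>1 \<pi> \<longleftrightarrow>
     limsup (\<lambda>T. ereal (1 / real T * (\<Sum>t<T. expected_backlog \<rho>0 \<rho>1 \<alpha>0 \<alpha>1 \<pi> t))) < \<infinity>"

definition arrival_law :: "nat \<Rightarrow> real \<Rightarrow> nat pmf \<Rightarrow> bool" where
  "arrival_law Amax l \<alpha> \<longleftrightarrow>
     set_pmf \<alpha> \<subseteq> {0..Amax} \<and> measure_pmf.expectation \<alpha> real = l"

definition stabilizes :: "nat \<Rightarrow> real \<Rightarrow> real \<Rightarrow> policy \<Rightarrow> real \<times> real \<Rightarrow> bool" where
  "stabilizes Amax \<rho>0 \<rho>1 \<pi> l \<longleftrightarrow>
     (\<forall>\<alpha>0 \<alpha>1. arrival_law Amax (fst l) \<alpha>0 \<longrightarrow> arrival_law Amax (snd l) \<alpha>1 \<longrightarrow>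
        strongly_stable \<rho>0 \<rho>1 \<alpha>0 \<alpha>1 \<pi>)"

text \<open>
  Arrivals bounded by \<open>Amax\<close> cannot have a mean above \<open>Amax\<close>, and every policy would vacuously
  stabilize such a rate vector. The conditions \<open>l0 + \<epsilon> \<le> real Amax\<close> and \<open>l1 + \<epsilon> \<le> real Amax\<close>
  exclude this degenerate case.
\<close>

definition achievable_rate_region :: "nat \<Rightarrow> real \<Rightarrow> real \<Rightarrow> (real \<times> real) set" where
  "achievable_rate_region Amax \<rho>0 \<rho>1 =
     {(l0, l1). 0 \<le> l0 \<and> 0 \<le> l1 \<and>
        (\<exists>\<epsilon>>0. l0 + \<epsilon> \<le> real Amax \<and> l1 + \<epsilon> \<le> real Amax \<and>
           (\<exists>\<pi>. is_policy \<pi> \<and> stabilizes Amax \<rho>0 \<rho>1 \<pi> (l0 + \<epsilon>, l1 + \<epsilon>)))}"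

end

theory Submission
  imports Defs
begin

text \<open>
  Both cases describe the set \<open>l1 < \<rho>1\<close>, \<open>l0 + l1 < \<rho>0 + \<rho>1 * (1 - \<rho>0)\<close>, \<open>2 * l0 + l1 < 1 + \<rho>0\<close>.
  Necessity of the three inequalities follows from the linear functions \<open>Q1\<close>, \<open>Q0 + Q1 + Q01\<close> and
  \<open>2 * Q0 + Q1 + Q01\<close> of the backlogs: whatever the policy does, one slot decreases them in expectation
  by at most \<open>\<rho>1\<close>, \<open>\<rho>0 + \<rho>1 * (1 - \<rho>0)\<close> and \<open>1 + \<rho>0\<close>, so an excess load makes the backlog grow
  linearly. For sufficiency, the max-weight policy makes the quadratic Lyapunov function drift towards zero,
  since its expected weight dominates that of every randomized allocation of the slots.
\<close>

section \<open>Conditional law of one slot and expected drift along a run\<close>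

locale relay_run =
  fixes \<rho>0 \<rho>1 :: real and Amax :: nat and l0 l1 :: real and \<alpha>0 \<alpha>1 :: "nat pmf" and \<pi> :: policy
  assumes rho0: "0 \<le> \<rho>0" "\<rho>0 \<le> 1" and rho1: "0 \<le> \<rho>1" "\<rho>1 \<le> 1"
    and arrival0: "arrival_law Amax l0 \<alpha>0" and arrival1: "arrival_law Amax l1 \<alpha>1"
    and policy: "is_policy \<pi>"
begin

abbreviation history :: "nat \<Rightarrow> slot list pmf" where
  "history \<equiv> history_pmf \<rho>0 \<rho>1 \<alpha>0 \<alpha>1 \<pi>"

abbreviation channel :: "(bool \<times> bool) pmf" where
  "channel \<equiv> pair_pmf (bernoulli_pmf \<rho>0) (bernoulli_pmf \<rho>1)"

definition slot_pmf :: "slot list \<Rightarrow> slot pmf" where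
  "slot_pmf h = do {
     s \<leftarrow> channel;
     x \<leftarrow> \<pi> h s;
     a \<leftarrow> pair_pmf \<alpha>0 \<alpha>1;
     return_pmf (s, x, a)
   }"

lemma history_Suc: "history (Suc t) = history t \<bind> (\<lambda>h. map_pmf (\<lambda>e. e # h) (slot_pmf h))"
  by (simp add: slot_pmf_def map_bind_pmf)

text \<open>The action may be correlated with the channel states and the past, but summing it out
  leaves the channel marginal unaffected by \<open>h\<close> and \<open>\<pi>\<close>.\<close>

lemma map_fst_slot_pmf: "map_pmf fst (slot_pmf h) = channel"
  by (simp add: slot_pmf_def map_bind_pmf bind_return_pmf')

lemma map_arrivals_slot_pmf: "map_pmf (\<lambda>e. snd (snd e)) (slot_pmf h) = pair_pmf \<alpha>0 \<alpha>1"
  by (simp add: slot_pmf_def map_bind_pmf bind_return_pmf')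

lemma set_pmf_policy: "set_pmf (\<pi> h s) \<subseteq> permitted (backlog_after h) s"
  using policy unfolding is_policy_def by blast

lemma set_slot_pmf:
  "(s, x, (a0, a1)) \<in> set_pmf (slot_pmf h) \<Longrightarrow> x \<in> set_pmf (\<pi> h s) \<and> a0 \<le> Amax \<and> a1 \<le> Amax"
  using arrival0 arrival1 by (auto simp: slot_pmf_def arrival_law_def)

text \<open>Five actions and arrivals bounded by \<open>Amax\<close> leave finitely many slots, so
  every real function below is integrable.\<close>

lemma finite_set_slot_pmf: "finite (set_pmf (slot_pmf h))"
proof (rule finite_subset)
  have "x \<in> {Idle, Send0, Forward, Send1, Send01}" for x
    by (cases x) auto
  then show "set_pmf (slot_pmf h) \<subseteq>
      UNIV \<times> {Idle, Send0, Forward, Send1, Send01} \<times> {..Amax} \<times> {..Amax}"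
    using set_slot_pmf by auto
qed simp

lemma finite_set_history: "finite (set_pmf (history t))"
  by (induction t) (use finite_set_slot_pmf in \<open>auto simp: history_Suc simp del: history_pmf.simps(2)\<close>)

lemma integrable_history [simp]: "integrable (history t) (f :: slot list \<Rightarrow> real)"
  by (rule integrable_measure_pmf_finite[OF finite_set_history])

lemma integrable_slot [simp]: "integrable (slot_pmf h) (f :: slot \<Rightarrow> real)"
  by (rule integrable_measure_pmf_finite[OF finite_set_slot_pmf])

lemma expectation_history_Suc:
  fixes f :: "slot list \<Rightarrow> real"
  shows "measure_pmf.expectation (history (Suc t)) f =
    measure_pmf.expectation (history t)
      (\<lambda>h. measure_pmf.expectation (slot_pmf h) (\<lambda>e. f (e # h)))"
proof -
  have "measure_pmf.expectation (history (Suc t)) f =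
    (\<Sum>h\<in>set_pmf (history t). pmf (history t) h *\<^sub>R
       measure_pmf.expectation (map_pmf (\<lambda>e. e # h) (slot_pmf h)) f)"
    unfolding history_Suc
    by (rule pmf_expectation_bind) (auto simp: finite_set_history finite_set_slot_pmf)
  then show ?thesis
    by (subst integral_measure_pmf_real[of "set_pmf (history t)"])
      (auto simp: finite_set_history mult.commute)
qed

lemma expectation_slot_arrivals:
  "measure_pmf.expectation (slot_pmf h) (\<lambda>e. real (fst (snd (snd e)))) = l0"
  "measure_pmf.expectation (slot_pmf h) (\<lambda>e. real (snd (snd (snd e)))) = l1"
proof -
  have "measure_pmf.expectation (slot_pmf h) (\<lambda>e. real (fst (snd (snd e))))
      = measure_pmf.expectation (pair_pmf \<alpha>0 \<alpha>1) (\<lambda>a. real (fst a))"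
    unfolding map_arrivals_slot_pmf[of h, symmetric] by simp
  then show "measure_pmf.expectation (slot_pmf h) (\<lambda>e. real (fst (snd (snd e)))) = l0"
    using arrival0 by (simp add: arrival_law_def)
  have "measure_pmf.expectation (slot_pmf h) (\<lambda>e. real (snd (snd (snd e))))
      = measure_pmf.expectation (pair_pmf \<alpha>0 \<alpha>1) (\<lambda>a. real (snd a))"
    unfolding map_arrivals_slot_pmf[of h, symmetric] by simp
  then show "measure_pmf.expectation (slot_pmf h) (\<lambda>e. real (snd (snd (snd e)))) = l1"
    using arrival1 by (simp add: arrival_law_def)
qed

lemma expectation_slot_channel:
  fixes F :: "bool \<times> bool \<Rightarrow> real"
  shows "measure_pmf.expectation (slot_pmf h) (\<lambda>e. F (fst e)) =
    \<rho>0 * \<rho>1 * F (True, True) + \<rho>0 * (1 - \<rho>1) * F (True, False)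
    + (1 - \<rho>0) * \<rho>1 * F (False, True) + (1 - \<rho>0) * (1 - \<rho>1) * F (False, False)"
proof -
  have "measure_pmf.expectation (slot_pmf h) (\<lambda>e. F (fst e)) = measure_pmf.expectation channel F"
    unfolding map_fst_slot_pmf[of h, symmetric] by simp
  also have "\<dots> = (\<Sum>s\<in>UNIV. F s * pmf channel s)"
    by (rule integral_measure_pmf_real) auto
  also have "\<dots> = (\<Sum>s\<in>{(True, True), (True, False), (False, True), (False, False)}. F s * pmf channel s)"
    by (rule sum.cong) auto
  finally show ?thesis
    using rho0 rho1 by (simp add: pmf_pair algebra_simps)
qed

text \<open>A bound on the one-slot change that no longer mentions the action involves only channel
  states and arrivals, whose marginals are known, so its conditional expectation given
  \<open>h\<close> is explicit. The coefficients may depend on \<open>h\<close>, which quadratic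
  functions require.\<close>

lemma expected_drift_le:
  fixes f :: "slot list \<Rightarrow> real"
  assumes "\<And>h s x a0 a1. \<lbrakk>x \<in> set_pmf (\<pi> h s); a0 \<le> Amax; a1 \<le> Amax\<rbrakk> \<Longrightarrow>
      f ((s, x, (a0, a1)) # h) \<le> f h + F h s + c0 h * real a0 + c1 h * real a1"
  shows "measure_pmf.expectation (history (Suc t)) f \<le>
    measure_pmf.expectation (history t) f +
    measure_pmf.expectation (history t) (\<lambda>h.
      \<rho>0 * \<rho>1 * F h (True, True) + \<rho>0 * (1 - \<rho>1) * F h (True, False)
      + (1 - \<rho>0) * \<rho>1 * F h (False, True) + (1 - \<rho>0) * (1 - \<rho>1) * F h (False, False)
      + c0 h * l0 + c1 h * l1)" (is "_ \<le> _ + measure_pmf.expectation _ ?D")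
proof -
  have "measure_pmf.expectation (slot_pmf h) (\<lambda>e. f (e # h)) \<le> f h + ?D h" for h
  proof -
    have "measure_pmf.expectation (slot_pmf h) (\<lambda>e. f (e # h)) \<le>
      measure_pmf.expectation (slot_pmf h) (\<lambda>e. f h + F h (fst e)
        + c0 h * real (fst (snd (snd e))) + c1 h * real (snd (snd (snd e))))"
      by (rule integral_mono_AE) (auto intro!: AE_pmfI assms dest!: set_slot_pmf)
    also have "\<dots> = f h + ?D h"
      by (simp add: expectation_slot_arrivals expectation_slot_channel)
    finally show ?thesis .
  qed
  then have "measure_pmf.expectation (history (Suc t)) f \<le>
      measure_pmf.expectation (history t) (\<lambda>h. f h + ?D h)"
    unfolding expectation_history_Suc by (intro integral_mono) auto
  then show ?thesis
    by (simp del: history_pmf.simps(2))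
qed

section \<open>Necessity: linear functions of the backlog\<close>

text \<open>\<open>G s\<close> bounds the decrease of \<open>c0 * Q0 + c1 * Q1 + c01 * Q01\<close>
  under every permitted action in state \<open>s\<close>; the conditions on \<open>G\<close> treat
  \<open>Idle\<close>, \<open>Send0\<close>, \<open>Forward\<close>, \<open>Send1\<close> and
  \<open>Send01\<close> in turn. A load above the mean of \<open>G\<close> would force linear growth
  of the expected backlog.\<close>

lemma linear_drift_bound:
  fixes c0 c1 c01 :: real
  assumes stable: "strongly_stable \<rho>0 \<rho>1 \<alpha>0 \<alpha>1 \<pi>"
    and c: "c0 \<in> {0..K}" "c1 \<in> {0..K}" "c01 \<in> {0..K}"
    and K: "K > 0"
    and G: "\<And>s. 0 \<le> G s" "\<And>s1. c0 \<le> G (True, s1)" "\<And>s. c0 - c01 \<le> G s"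
      "\<And>s0. c1 \<le> G (s0, True)" "\<And>s0. c01 \<le> G (s0, True)"
  shows "c0 * l0 + c1 * l1 \<le>
    \<rho>0 * \<rho>1 * G (True, True) + \<rho>0 * (1 - \<rho>1) * G (True, False)
    + (1 - \<rho>0) * \<rho>1 * G (False, True) + (1 - \<rho>0) * (1 - \<rho>1) * G (False, False)"
    (is "_ \<le> ?g")
proof (rule ccontr)
  define V where "V h = c0 * real (queue0 (backlog_after h)) + c1 * real (queue1 (backlog_after h))
    + c01 * real (queue01 (backlog_after h))" for h
  define k where "k = c0 * l0 + c1 * l1 - ?g"
  assume "\<not> c0 * l0 + c1 * l1 \<le> ?g"
  then have k: "k > 0" by (simp add: k_def)
  let ?u = "expected_backlog \<rho>0 \<rho>1 \<alpha>0 \<alpha>1 \<pi>"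
  have EV: "real t * k \<le> measure_pmf.expectation (history t) V" for t
  proof (induction t)
    case 0
    show ?case by (simp add: V_def)
  next
    case (Suc t)
    \<comment> \<open>The drift lemma yields upper bounds only, so the lower bound on
      \<open>V\<close> is obtained from \<open>- V\<close>.\<close>
    have "measure_pmf.expectation (history (Suc t)) (\<lambda>h. - V h) \<le>
      measure_pmf.expectation (history t) (\<lambda>h. - V h) +
      measure_pmf.expectation (history t) (\<lambda>h. ?g + (- c0) * l0 + (- c1) * l1)"
    proof (rule expected_drift_le)
      fix h s x a0 a1
      assume "x \<in> set_pmf (\<pi> h s)"
      then have x: "x \<in> permitted (backlog_after h) s" using set_pmf_policy by blast
      obtain s0 s1 where s: "s = (s0, s1)" by (cases s)
      obtain q0 q1 q01 where q: "backlog_after h = Backlog q0 q1 q01" by (cases "backlog_after h")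
      show "- V ((s, x, a0, a1) # h) \<le> - V h + G s + - c0 * real a0 + - c1 * real a1"
        using x G(1)[of s] G(2)[of s1] G(3)[of s] G(4)[of s0] G(5)[of s0]
        by (auto simp: V_def q s algebra_simps of_nat_diff)
    qed
    then show ?case
      using Suc.IH by (simp add: k_def algebra_simps del: history_pmf.simps(2))
  qed
  have "measure_pmf.expectation (history t) V \<le> K * ?u t" for t
  proof -
    have "measure_pmf.expectation (history t) V \<le> measure_pmf.expectation (history t) (\<lambda>h. K *
      real (queue0 (backlog_after h) + queue1 (backlog_after h) + queue01 (backlog_after h)))"
      using c by (intro integral_mono) (auto simp: V_def algebra_simps intro!: add_mono mult_right_mono)
    then show ?thesis by (simp add: expected_backlog_def)
  qed
  then have "real t * k \<le> K * ?u t" for t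
    using EV order_trans by blast
  then have u: "real t * (k / K) \<le> ?u t" for t
    using K by (simp add: field_simps)
  obtain C where C: "limsup (\<lambda>T. ereal (1 / real T * (\<Sum>t<T. ?u t))) < ereal C"
    using stable less_PInf_Ex_of_nat unfolding strongly_stable_def by fastforce
  obtain N where N: "\<And>T. T \<ge> N \<Longrightarrow> 1 / real T * (\<Sum>t<T. ?u t) < C"
    using Limsup_lessD[OF C] by (auto simp: eventually_sequentially)
  \<comment> \<open>The average of \<open>t * (k / K)\<close> over \<open>t < T\<close> is
    \<open>(T - 1) / 2 * (k / K)\<close>; this \<open>T\<close> makes it at least
    \<open>\<bar>C\<bar>\<close> and lies in the range where the averages stay below
    \<open>C\<close>.\<close>
  define T where "T = max N 1 + nat \<lceil>2 * \<bar>C\<bar> * K / k\<rceil> + 1"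
  have T: "T \<ge> N" "T \<ge> 1" "2 * \<bar>C\<bar> * K / k \<le> real T - 1"
    unfolding T_def by (auto; linarith)+
  have "(\<Sum>t<T. real t) = real T * (real T - 1) / 2" for T
    by (induction T) (auto simp: field_simps)
  then have "real T * (real T - 1) / 2 * (k / K) = (\<Sum>t<T. real t * (k / K))"
    by (simp only: sum_distrib_right[symmetric])
  also have "\<dots> \<le> (\<Sum>t<T. ?u t)" by (intro sum_mono u)
  also have "\<dots> < real T * C" using N[OF T(1)] T(2) by (simp add: field_simps)
  finally have "real T * ((real T - 1) / 2 * (k / K)) < real T * C"
    by (simp add: mult.assoc)
  then have "(real T - 1) / 2 * (k / K) < C" using T(2) by (subst (asm) mult_less_cancel_left_pos) auto
  moreover have "\<bar>C\<bar> \<le> (real T - 1) / 2 * (k / K)" using T(3) k K by (simp add: field_simps)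
  ultimately show False by linarith
qed

section \<open>Lyapunov criterion for strong stability\<close>

text \<open>The drift inequality telescopes from \<open>L [] = 0\<close>; dropping the nonnegative
  final value of \<open>L\<close> bounds the averaged backlog by \<open>B / \<eta>\<close>.\<close>

lemma strongly_stable_if_drift:
  fixes L :: "slot list \<Rightarrow> real"
  assumes L: "\<And>h. 0 \<le> L h" and \<eta>: "\<eta> > 0"
    and drift: "\<And>t. measure_pmf.expectation (history (Suc t)) L \<le>
      measure_pmf.expectation (history t) L + B - \<eta> * expected_backlog \<rho>0 \<rho>1 \<alpha>0 \<alpha>1 \<pi> t"
    and L_Nil: "L [] = 0"
  shows "strongly_stable \<rho>0 \<rho>1 \<alpha>0 \<alpha>1 \<pi>"
proof -
  let ?u = "expected_backlog \<rho>0 \<rho>1 \<alpha>0 \<alpha>1 \<pi>"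
  have "measure_pmf.expectation (history T) L + \<eta> * (\<Sum>t<T. ?u t) \<le> real T * B" for T
  proof (induction T)
    case 0
    show ?case by (simp add: L_Nil)
  next
    case (Suc T)
    then show ?case using drift[of T] by (simp add: algebra_simps del: history_pmf.simps(2))
  qed
  moreover have "measure_pmf.expectation (history T) L \<ge> 0" for T
    using L by simp
  ultimately have bound: "\<eta> * (\<Sum>t<T. ?u t) \<le> real T * B" for T
    by (smt (verit))
  have "1 / real T * (\<Sum>t<T. ?u t) \<le> B / \<eta>" if "T \<ge> 1" for T
    using bound[of T] \<eta> that by (simp add: field_simps)
  then have "limsup (\<lambda>T. ereal (1 / real T * (\<Sum>t<T. ?u t))) \<le> ereal (B / \<eta>)"
    by (intro Limsup_bounded) (auto simp: eventually_sequentially)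
  then show ?thesis
    unfolding strongly_stable_def by (rule order.strict_trans1) simp
qed

end

section \<open>The max-weight policy and its quadratic drift\<close>

text \<open>To first order, an action lowers the sum of squared queues by twice its weight.
  Forwarding thus earns the differential backlog, which may be negative.\<close>

fun weight :: "backlog \<Rightarrow> action \<Rightarrow> real" where
  "weight q Idle = 0"
| "weight q Send0 = real (queue0 q)"
| "weight q Forward = real (queue0 q) - real (queue01 q)"
| "weight q Send1 = real (queue1 q)"
| "weight q Send01 = real (queue01 q)"

definition max_weight_action :: "backlog \<Rightarrow> bool \<times> bool \<Rightarrow> action" where
  "max_weight_action q s =
    (SOME x. x \<in> permitted q s \<and> (\<forall>y \<in> permitted q s. weight q y \<le> weight q x))"

definition max_weight :: policy where
  "max_weight h s = return_pmf (max_weight_action (backlog_after h) s)"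

text \<open>The permitted set is finite and contains \<open>Idle\<close>, so a maximizer exists for
  \<open>SOME\<close> to pick.\<close>

lemma max_weight_action:
  shows max_weight_action_permitted: "max_weight_action q s \<in> permitted q s"
    and weight_le_max_weight: "y \<in> permitted q s \<Longrightarrow> weight q y \<le> weight q (max_weight_action q s)"
proof -
  let ?P = "permitted q s"
  obtain s0 s1 where s: "s = (s0, s1)" by (cases s)
  have "finite ?P" "?P \<noteq> {}" by (auto simp: s)
  then have Max: "Max (weight q ` ?P) \<in> weight q ` ?P"
      "\<And>y. y \<in> ?P \<Longrightarrow> weight q y \<le> Max (weight q ` ?P)"
    by (simp_all del: permitted.simps)
  from Max(1) obtain x where "x \<in> ?P" "Max (weight q ` ?P) = weight q x"
    by blast
  with Max(2) have "\<exists>x. x \<in> ?P \<and> (\<forall>y \<in> ?P. weight q y \<le> weight q x)"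
    by metis
  then have *: "max_weight_action q s \<in> ?P \<and> (\<forall>y \<in> ?P. weight q y \<le> weight q (max_weight_action q s))"
    unfolding max_weight_action_def by (rule someI_ex)
  then show "max_weight_action q s \<in> permitted q s" by simp
  show "y \<in> permitted q s \<Longrightarrow> weight q y \<le> weight q (max_weight_action q s)" using * by simp
qed

lemma is_policy_max_weight: "is_policy max_weight"
  by (simp add: is_policy_def max_weight_def max_weight_action_permitted)

text \<open>An action that is blocked only by an empty queue has nonpositive weight, so it may be compared
  with the maximal weight like a permitted one.\<close>

lemma weight_max_weight_ge:
  fixes q s0 s1
  defines "W \<equiv> weight q (max_weight_action q (s0, s1))"
  shows "0 \<le> W" "real (queue0 q) - real (queue01 q) \<le> W"
    "s0 \<Longrightarrow> real (queue0 q) \<le> W" "s1 \<Longrightarrow> real (queue1 q) \<le> W" "s1 \<Longrightarrow> real (queue01 q) \<le> W"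
proof -
  note le = weight_le_max_weight[of _ q "(s0, s1)", folded W_def]
  show W: "0 \<le> W" using le[of Idle] by simp
  show "real (queue0 q) - real (queue01 q) \<le> W"
    using le[of Forward] W by (cases "queue0 q = 0") auto
  show "s0 \<Longrightarrow> real (queue0 q) \<le> W"
    using le[of Send0] W by (cases "queue0 q = 0") auto
  show "s1 \<Longrightarrow> real (queue1 q) \<le> W"
    using le[of Send1] W by (cases "queue1 q = 0") auto
  show "s1 \<Longrightarrow> real (queue01 q) \<le> W"
    using le[of Send01] W by (cases "queue01 q = 0") auto
qed


lemma square_add_le:
  fixes q d :: real
  assumes "\<bar>d\<bar> \<le> c"
  shows "(q + d)\<^sup>2 \<le> q\<^sup>2 + 2 * q * d + c\<^sup>2"
proof -
  have "d\<^sup>2 \<le> c\<^sup>2" using assms by (simp add: abs_le_square_iff[symmetric])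
  then show ?thesis by (simp add: power2_sum)
qed

text \<open>Each queue changes by at most \<open>A + 1\<close>, so the three squared increments go
  into the constant; the cross terms amount to arrivals minus weight. The right-hand side has the
  shape required by \<open>expected_drift_le\<close>.\<close>

lemma quadratic_drift:
  fixes q :: backlog and A :: nat
  assumes x: "x \<in> permitted q s" and a: "a0 \<le> A" "a1 \<le> A"
  defines "L \<equiv> \<lambda>q. (real (queue0 q))\<^sup>2 + (real (queue1 q))\<^sup>2 + (real (queue01 q))\<^sup>2"
  shows "L (arrive (a0, a1) (transmit x q)) \<le>
    L q + (3 * (real A + 1)\<^sup>2 - 2 * weight q x)
    + 2 * real (queue0 q) * real a0 + 2 * real (queue1 q) * real a1"
proof -
  obtain q0 q1 q01 where q: "q = Backlog q0 q1 q01" by (cases q)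
  obtain s0 s1 where s: "s = (s0, s1)" by (cases s)
  define d0 d1 d01 :: real where
    "d0 = real a0 - (if x = Send0 \<or> x = Forward then 1 else 0)" and
    "d1 = real a1 - (if x = Send1 then 1 else 0)" and
    "d01 = (if x = Forward then 1 else if x = Send01 then -1 else 0)"
  \<comment> \<open>A permitted action never truncates the natural-number subtraction, so the
    increments are exact over the reals.\<close>
  have "L (arrive (a0, a1) (transmit x q)) = (q0 + d0)\<^sup>2 + (q1 + d1)\<^sup>2 + (q01 + d01)\<^sup>2"
    using x by (auto simp: L_def q s d0_def d1_def d01_def of_nat_diff algebra_simps)
  also have "\<dots> \<le> L q + 3 * (real A + 1)\<^sup>2 + 2 * q0 * d0 + 2 * q1 * d1 + 2 * q01 * d01"
  proof -
    have "\<bar>d0\<bar> \<le> real A + 1" "\<bar>d1\<bar> \<le> real A + 1" "\<bar>d01\<bar> \<le> real A + 1"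
      using a by (auto simp: d0_def d1_def d01_def)
    from this[THEN square_add_le] show ?thesis
      by (simp add: L_def q) (smt (verit))
  qed
  finally have "L (arrive (a0, a1) (transmit x q)) \<le>
      L q + 3 * (real A + 1)\<^sup>2 + 2 * q0 * d0 + 2 * q1 * d1 + 2 * q01 * d01" .
  moreover have "2 * q0 * d0 + 2 * q1 * d1 + 2 * q01 * d01 = 2 * q0 * a0 + 2 * q1 * a1 - 2 * weight q x"
    by (cases x) (simp_all add: q d0_def d1_def d01_def algebra_simps)
  ultimately show ?thesis by (simp add: q)
qed

text \<open>The slack inequality cancels the arrival terms of the quadratic drift and leaves
  \<open>- 2 * \<eta>\<close> times the total backlog.\<close>

lemma (in relay_run) strongly_stable_if_max_weight_slack:
  fixes \<eta> :: real
  assumes \<pi>: "\<pi> = max_weight" and \<eta>: "\<eta> > 0"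
    and slack: "\<And>q. (l0 + \<eta>) * real (queue0 q) + (l1 + \<eta>) * real (queue1 q) + \<eta> * real (queue01 q) \<le>
      \<rho>0 * \<rho>1 * weight q (max_weight_action q (True, True))
      + \<rho>0 * (1 - \<rho>1) * weight q (max_weight_action q (True, False))
      + (1 - \<rho>0) * \<rho>1 * weight q (max_weight_action q (False, True))
      + (1 - \<rho>0) * (1 - \<rho>1) * weight q (max_weight_action q (False, False))"
  shows "strongly_stable \<rho>0 \<rho>1 \<alpha>0 \<alpha>1 \<pi>"
proof -
  define L where "L q = (real (queue0 q))\<^sup>2 + (real (queue1 q))\<^sup>2 + (real (queue01 q))\<^sup>2" for q
  define B where "B = 3 * (real Amax + 1)\<^sup>2"
  define W where "W q s = weight q (max_weight_action q s)" for q s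
  define S where "S q = real (queue0 q + queue1 q + queue01 q)" for q
  let ?q = backlog_after
  show ?thesis
  proof (rule strongly_stable_if_drift[where L = "\<lambda>h. L (?q h)" and \<eta> = "2 * \<eta>" and B = B])
    fix t
    let ?D = "\<lambda>h. \<rho>0 * \<rho>1 * (B - 2 * W (?q h) (True, True))
        + \<rho>0 * (1 - \<rho>1) * (B - 2 * W (?q h) (True, False))
        + (1 - \<rho>0) * \<rho>1 * (B - 2 * W (?q h) (False, True))
        + (1 - \<rho>0) * (1 - \<rho>1) * (B - 2 * W (?q h) (False, False))
        + 2 * real (queue0 (?q h)) * l0 + 2 * real (queue1 (?q h)) * l1"
    have "measure_pmf.expectation (history (Suc t)) (\<lambda>h. L (?q h)) \<le>
      measure_pmf.expectation (history t) (\<lambda>h. L (?q h)) + measure_pmf.expectation (history t) ?D"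
    proof (rule expected_drift_le)
      fix h s x a0 a1
      assume "x \<in> set_pmf (\<pi> h s)" and a: "a0 \<le> Amax" "a1 \<le> Amax"
      then have x: "x = max_weight_action (?q h) s" by (simp add: \<pi> max_weight_def)
      show "L (?q ((s, x, a0, a1) # h)) \<le> L (?q h) + (B - 2 * W (?q h) s)
          + 2 * real (queue0 (?q h)) * real a0 + 2 * real (queue1 (?q h)) * real a1"
        using quadratic_drift[OF max_weight_action_permitted a, of "?q h" s]
        by (simp add: x L_def B_def W_def)
    qed
    also have "measure_pmf.expectation (history t) ?D \<le>
      measure_pmf.expectation (history t) (\<lambda>h. B - 2 * \<eta> * S (?q h))"
    proof (rule integral_mono)
      fix h
      \<comment> \<open>The four channel probabilities sum to 1, so the constants combine to a
        single \<open>B\<close>.\<close>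
      have "?D h = B - 2 * (\<rho>0 * \<rho>1 * W (?q h) (True, True)
        + \<rho>0 * (1 - \<rho>1) * W (?q h) (True, False)
        + (1 - \<rho>0) * \<rho>1 * W (?q h) (False, True)
        + (1 - \<rho>0) * (1 - \<rho>1) * W (?q h) (False, False))
        + 2 * real (queue0 (?q h)) * l0 + 2 * real (queue1 (?q h)) * l1"
        by (simp add: algebra_simps)
      also have "\<dots> \<le> B - 2 * ((l0 + \<eta>) * real (queue0 (?q h))
        + (l1 + \<eta>) * real (queue1 (?q h)) + \<eta> * real (queue01 (?q h)))
        + 2 * real (queue0 (?q h)) * l0 + 2 * real (queue1 (?q h)) * l1"
        using slack[of "?q h"] by (simp add: W_def)
      also have "\<dots> = B - 2 * \<eta> * S (?q h)"
        by (simp add: S_def algebra_simps)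
      finally show "?D h \<le> B - 2 * \<eta> * S (?q h)" .
    qed simp_all
    finally show "measure_pmf.expectation (history (Suc t)) (\<lambda>h. L (?q h)) \<le>
      measure_pmf.expectation (history t) (\<lambda>h. L (?q h)) + B
      - 2 * \<eta> * expected_backlog \<rho>0 \<rho>1 \<alpha>0 \<alpha>1 \<pi> t"
      by (simp add: expected_backlog_def S_def del: history_pmf.simps(2))
  qed (use \<eta> in \<open>simp_all add: L_def\<close>)
qed

section \<open>Slack of the max-weight policy inside the region\<close>

lemma max_weight_slack:
  fixes \<rho>0 \<rho>1 l0 l1 :: real
  assumes \<rho>: "0 \<le> \<rho>0" "\<rho>0 \<le> 1" "0 \<le> \<rho>1" "\<rho>1 \<le> 1" and l: "0 \<le> l0" "0 \<le> l1"
    and rate: "l1 < \<rho>1" "l0 + l1 < \<rho>0 + \<rho>1 * (1 - \<rho>0)" "2 * l0 + l1 < 1 + \<rho>0"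
  obtains \<eta> where "\<eta> > 0"
    "\<And>q. (l0 + \<eta>) * real (queue0 q) + (l1 + \<eta>) * real (queue1 q) + \<eta> * real (queue01 q) \<le>
      \<rho>0 * \<rho>1 * weight q (max_weight_action q (True, True))
      + \<rho>0 * (1 - \<rho>1) * weight q (max_weight_action q (True, False))
      + (1 - \<rho>0) * \<rho>1 * weight q (max_weight_action q (False, True))
      + (1 - \<rho>0) * (1 - \<rho>1) * weight q (max_weight_action q (False, False))"
proof -
  \<comment> \<open>The divisor 4 is dictated by the bound on \<open>2 * l0 + l1\<close>: serving
    \<open>l0 + \<eta>\<close> counts twice and node 1 is asked for
    \<open>l1 + 2 * \<eta>\<close>.\<close>
  define \<eta> where "\<eta> = min (\<rho>1 - l1)
    (min (\<rho>0 + \<rho>1 * (1 - \<rho>0) - l0 - l1) (1 + \<rho>0 - 2 * l0 - l1)) / 4"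
  have \<eta>: "\<eta> > 0" "4 * \<eta> \<le> \<rho>1 - l1" "4 * \<eta> \<le> \<rho>0 + \<rho>1 * (1 - \<rho>0) - l0 - l1"
    "4 * \<eta> \<le> 1 + \<rho>0 - 2 * l0 - l1"
    using rate by (auto simp: \<eta>_def)
  define p11 p10 p01 p00 where p_defs: "p11 = \<rho>0 * \<rho>1" "p10 = \<rho>0 * (1 - \<rho>1)"
    "p01 = (1 - \<rho>0) * \<rho>1" "p00 = (1 - \<rho>0) * (1 - \<rho>1)"
  have p: "0 \<le> p11" "0 \<le> p10" "0 \<le> p01" "0 \<le> p00"
    using \<rho> by (auto simp: p_defs)
  have p_sums: "p11 + p10 = \<rho>0" "p11 + p01 = \<rho>1" "p01 + p00 = 1 - \<rho>0"
    "\<rho>1 * (1 - \<rho>0) = p01"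
    by (auto simp: p_defs algebra_simps)
  \<comment> \<open>Only the lower bounds on the maximal weights matter, so queues and weights
    become arbitrary reals.\<close>
  have main: "(l0 + \<eta>) * q0 + (l1 + \<eta>) * q1 + \<eta> * q01 \<le> p11 * w11 + p10 * w10 + p01 * w01 + p00 * w00"
    if q: "0 \<le> q0" "0 \<le> q1" "0 \<le> q01"
      and w11: "q0 \<le> w11" "q1 \<le> w11" "q01 \<le> w11" and w10: "q0 \<le> w10"
      and w01: "0 \<le> w01" "q0 - q01 \<le> w01" "q1 \<le> w01" "q01 \<le> w01"
      and w00: "0 \<le> w00" "q0 - q01 \<le> w00"
    for q0 q1 q01 w11 w10 w01 w00 :: real
  proof -
    \<comment> \<open>\<open>m\<close> is the best weight for a transmission by node 1,
      \<open>v\<close> the better of idling and forwarding.\<close>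
    define m v where "m = max q1 q01" and "v = max 0 (q0 - q01)"
    have m: "q1 \<le> m" "q01 \<le> m" "m \<le> w11" "m \<le> w01" "0 \<le> m"
      and v: "0 \<le> v" "q0 - q01 \<le> v" "v \<le> w01" "v \<le> w00"
      using that by (auto simp: m_def v_def)
    \<comment> \<open>Weights are compared with an explicit allocation. If node 1 alone fills the slots in which only
      its channel is ON, node 0 sends directly in the rest of its ON slots and \<open>\<eta>\<close> covers \<open>q01\<close>.
      Otherwise node 0 sends directly whenever it is ON, and the missing rate \<open>f\<close> is relayed.\<close>
    show ?thesis
    proof (cases "l1 + 2 * \<eta> \<le> p01")
      case False
      \<comment> \<open>\<open>y\<close> is the share of the both-ON slots that node 1 needs. The
        bound on \<open>l1\<close> gives \<open>y \<le> p11\<close>; the bound on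
        \<open>l0 + l1\<close> leaves enough slots for node 0.\<close>
      define y where "y = l1 + 2 * \<eta> - p01"
      have y: "0 \<le> y" "y \<le> p11" "p10 + (p11 - y) \<ge> l0 + \<eta>"
        using False \<eta> p_sums by (auto simp: y_def)
      have "(l1 + \<eta>) * q1 + \<eta> * q01 \<le> (l1 + \<eta>) * m + \<eta> * m"
        using m \<eta> l by (intro add_mono mult_left_mono) auto
      also have "\<dots> = p01 * m + y * m"
        by (simp add: y_def algebra_simps)
      also have "\<dots> \<le> p01 * w01 + y * w11"
        using m p y by (intro add_mono mult_left_mono) auto
      finally have 1: "(l1 + \<eta>) * q1 + \<eta> * q01 \<le> p01 * w01 + y * w11" .
      have "(l0 + \<eta>) * q0 \<le> (p10 + (p11 - y)) * q0"
        using y q by (intro mult_right_mono) auto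
      also have "\<dots> \<le> p10 * w10 + (p11 - y) * w11"
        unfolding distrib_right using y p w11 w10 by (intro add_mono mult_left_mono) auto
      finally have "(l0 + \<eta>) * q0 \<le> p10 * w10 + (p11 - y) * w11" .
      moreover have "0 \<le> p00 * w00" using p w00 by simp
      ultimately show ?thesis using 1 by (simp add: algebra_simps)
    next
      case True
      define f where "f = max 0 (l0 + \<eta> - \<rho>0)"
      \<comment> \<open>\<open>z\<close> is what remains of \<open>p01\<close> for forwarding. When
        \<open>f > 0\<close>, \<open>f \<le> z + p00\<close> is the bound on
        \<open>2 * l0 + l1\<close>: a relayed packet takes two slots, so \<open>f\<close> is charged
        twice.\<close>
      define z where "z = p01 - (l1 + 2 * \<eta> + f)"
      have f: "0 \<le> f" "l0 + \<eta> \<le> \<rho>0 + f" and z: "0 \<le> z" "f \<le> z + p00"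
        using True \<eta> p_sums p by (auto simp: f_def z_def max_def)
      have "(l1 + \<eta>) * q1 + (f + \<eta>) * q01 \<le> (l1 + \<eta>) * m + (f + \<eta>) * m"
        using m \<eta> l f by (intro add_mono mult_left_mono) auto
      also have "\<dots> = (p01 - z) * m"
        by (simp add: z_def algebra_simps)
      also have "\<dots> \<le> (p01 - z) * w01"
        using m l \<eta> f by (intro mult_left_mono) (auto simp: z_def)
      finally have 1: "(l1 + \<eta>) * q1 + (f + \<eta>) * q01 \<le> (p01 - z) * w01" .
      have "f * (q0 - q01) \<le> f * v"
        using f v by (intro mult_left_mono) auto
      also have "\<dots> \<le> (z + p00) * v"
        using z v by (intro mult_right_mono) auto
      also have "\<dots> \<le> z * w01 + p00 * w00"
        unfolding distrib_right using z p v by (intro add_mono mult_left_mono) auto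
      finally have 2: "f * (q0 - q01) \<le> z * w01 + p00 * w00" .
      have "(l0 + \<eta>) * q0 \<le> (p11 + p10 + f) * q0"
        using f q p_sums by (intro mult_right_mono) auto
      moreover have "p11 * q0 \<le> p11 * w11" "p10 * q0 \<le> p10 * w10"
        using p w11 w10 by (auto intro: mult_left_mono)
      \<comment> \<open>The two hops recombine:
        \<open>f * (q0 - q01) + f * q01 = f * q0\<close>.\<close>
      ultimately show ?thesis using 1 2 by (simp add: algebra_simps)
    qed
  qed
  show thesis
  proof (rule that[of \<eta>, OF \<eta>(1)])
    fix q
    show "(l0 + \<eta>) * real (queue0 q) + (l1 + \<eta>) * real (queue1 q) + \<eta> * real (queue01 q) \<le>
      \<rho>0 * \<rho>1 * weight q (max_weight_action q (True, True))
      + \<rho>0 * (1 - \<rho>1) * weight q (max_weight_action q (True, False))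
      + (1 - \<rho>0) * \<rho>1 * weight q (max_weight_action q (False, True))
      + (1 - \<rho>0) * (1 - \<rho>1) * weight q (max_weight_action q (False, False))"
      unfolding p_defs[symmetric] by (rule main) (auto intro: weight_max_weight_ge)
  qed
qed

section \<open>The rate region and its two-case form\<close>

text \<open>A law on \<open>0\<close> and \<open>Amax\<close> attains every mean in between; it
  keeps the stabilization hypothesis from being vacuous in the necessity proof.\<close>

lemma arrival_law_exists:
  assumes "0 \<le> l" "l \<le> real Amax" "1 \<le> Amax"
  obtains \<alpha> where "arrival_law Amax l \<alpha>"
proof
  show "arrival_law Amax l (map_pmf (\<lambda>b. if b then Amax else 0) (bernoulli_pmf (l / real Amax)))"
    using assms by (auto simp: arrival_law_def)
qed

lemma stabilizes_max_weight:
  assumes "0 \<le> \<rho>0" "\<rho>0 \<le> 1" "0 \<le> \<rho>1" "\<rho>1 \<le> 1" "0 \<le> l0" "0 \<le> l1"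
    and "l1 < \<rho>1" "l0 + l1 < \<rho>0 + \<rho>1 * (1 - \<rho>0)" "2 * l0 + l1 < 1 + \<rho>0"
  shows "stabilizes Amax \<rho>0 \<rho>1 max_weight (l0, l1)"
  unfolding stabilizes_def
proof (intro allI impI)
  fix \<alpha>0 \<alpha>1
  assume "arrival_law Amax (fst (l0, l1)) \<alpha>0" "arrival_law Amax (snd (l0, l1)) \<alpha>1"
  then interpret relay_run \<rho>0 \<rho>1 Amax l0 l1 \<alpha>0 \<alpha>1 max_weight
    using assms is_policy_max_weight by unfold_locales auto
  show "strongly_stable \<rho>0 \<rho>1 \<alpha>0 \<alpha>1 max_weight"
    by (rule max_weight_slack[OF assms], rule strongly_stable_if_max_weight_slack[OF refl])
qed

lemma stabilizes_imp_rate_bounds: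
  assumes \<rho>: "0 \<le> \<rho>0" "\<rho>0 \<le> 1" "0 \<le> \<rho>1" "\<rho>1 \<le> 1" and Amax: "1 \<le> Amax"
    and l: "0 \<le> l0" "l0 \<le> real Amax" "0 \<le> l1" "l1 \<le> real Amax"
    and \<pi>: "is_policy \<pi>" "stabilizes Amax \<rho>0 \<rho>1 \<pi> (l0, l1)"
  shows "l1 \<le> \<rho>1" "l0 + l1 \<le> \<rho>0 + \<rho>1 * (1 - \<rho>0)" "2 * l0 + l1 \<le> 1 + \<rho>0"
proof -
  obtain \<alpha>0 where \<alpha>0: "arrival_law Amax l0 \<alpha>0" using arrival_law_exists l Amax by blast
  obtain \<alpha>1 where \<alpha>1: "arrival_law Amax l1 \<alpha>1" using arrival_law_exists l Amax by blast
  interpret relay_run \<rho>0 \<rho>1 Amax l0 l1 \<alpha>0 \<alpha>1 \<pi>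
    using \<rho> \<alpha>0 \<alpha>1 \<pi> by unfold_locales auto
  have stable: "strongly_stable \<rho>0 \<rho>1 \<alpha>0 \<alpha>1 \<pi>"
    using \<pi>(2) \<alpha>0 \<alpha>1 by (simp add: stabilizes_def)
  \<comment> \<open>The numerals below instantiate \<open>c0\<close>, \<open>K\<close>,
    \<open>c1\<close>, \<open>c01\<close> in this order; the last argument is the largest decrease
    in each channel state.\<close>
  show "l1 \<le> \<rho>1"
    using linear_drift_bound[OF stable, of 0 1 1 0 "\<lambda>s. of_bool (snd s)"]
    by (simp add: algebra_simps)
  show "l0 + l1 \<le> \<rho>0 + \<rho>1 * (1 - \<rho>0)"
    using linear_drift_bound[OF stable, of 1 1 1 1 "\<lambda>s. of_bool (fst s \<or> snd s)"]
    by (simp add: algebra_simps)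
  \<comment> \<open>Counting remaining hops, a packet in \<open>Q0\<close> has value 2: direct
    delivery gains 2, every other transmission gains 1.\<close>
  show "2 * l0 + l1 \<le> 1 + \<rho>0"
    using linear_drift_bound[OF stable, of 2 2 1 1 "\<lambda>s. if fst s then 2 else 1"]
    by (simp add: algebra_simps)
qed

lemma achievable_rate_region_eq:
  assumes \<rho>: "0 \<le> \<rho>0" "\<rho>0 \<le> 1" "0 \<le> \<rho>1" "\<rho>1 \<le> 1" and Amax: "1 \<le> Amax"
  shows "achievable_rate_region Amax \<rho>0 \<rho>1 =
    {(l0, l1). 0 \<le> l0 \<and> 0 \<le> l1 \<and> l1 < \<rho>1 \<and> l0 + l1 < \<rho>0 + \<rho>1 * (1 - \<rho>0) \<and> 2 * l0 + l1 < 1 + \<rho>0}"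
proof (intro set_eqI iffI; clarify)
  fix l0 l1
  assume "(l0, l1) \<in> achievable_rate_region Amax \<rho>0 \<rho>1"
  then obtain \<epsilon> \<pi> where "0 \<le> l0" "0 \<le> l1" "\<epsilon> > 0" "l0 + \<epsilon> \<le> real Amax" "l1 + \<epsilon> \<le> real Amax"
    "is_policy \<pi>" "stabilizes Amax \<rho>0 \<rho>1 \<pi> (l0 + \<epsilon>, l1 + \<epsilon>)"
    by (auto simp: achievable_rate_region_def)
  moreover from this have "l1 + \<epsilon> \<le> \<rho>1" "(l0 + \<epsilon>) + (l1 + \<epsilon>) \<le> \<rho>0 + \<rho>1 * (1 - \<rho>0)"
    "2 * (l0 + \<epsilon>) + (l1 + \<epsilon>) \<le> 1 + \<rho>0"
    using stabilizes_imp_rate_bounds[OF \<rho> Amax, of "l0 + \<epsilon>" "l1 + \<epsilon>" \<pi>] by auto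
  ultimately show "0 \<le> l0 \<and> 0 \<le> l1 \<and> l1 < \<rho>1 \<and> l0 + l1 < \<rho>0 + \<rho>1 * (1 - \<rho>0) \<and> 2 * l0 + l1 < 1 + \<rho>0"
    by auto
next
  fix l0 l1 :: real
  assume l: "0 \<le> l0" "0 \<le> l1" "l1 < \<rho>1" "l0 + l1 < \<rho>0 + \<rho>1 * (1 - \<rho>0)" "2 * l0 + l1 < 1 + \<rho>0"
  \<comment> \<open>Raising both rates by \<open>\<epsilon>\<close> costs at most
    \<open>3 * \<epsilon>\<close> in any constraint, so a quarter of the least slack keeps all of
    them strict.\<close>
  define \<epsilon> where "\<epsilon> = min (\<rho>1 - l1)
    (min (\<rho>0 + \<rho>1 * (1 - \<rho>0) - l0 - l1) (1 + \<rho>0 - 2 * l0 - l1)) / 4"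
  have "\<epsilon> > 0" "4 * \<epsilon> \<le> \<rho>1 - l1" "4 * \<epsilon> \<le> \<rho>0 + \<rho>1 * (1 - \<rho>0) - l0 - l1"
    "4 * \<epsilon> \<le> 1 + \<rho>0 - 2 * l0 - l1"
    using l by (auto simp: \<epsilon>_def)
  then have \<epsilon>: "\<epsilon> > 0" "l1 + \<epsilon> < \<rho>1" "(l0 + \<epsilon>) + (l1 + \<epsilon>) < \<rho>0 + \<rho>1 * (1 - \<rho>0)"
    "2 * (l0 + \<epsilon>) + (l1 + \<epsilon>) < 1 + \<rho>0"
    by auto
  \<comment> \<open>The strict constraints put both raised rates below 1, hence below
    \<open>Amax\<close>.\<close>
  have "l0 + \<epsilon> \<le> real Amax" "l1 + \<epsilon> \<le> real Amax"
    using \<epsilon> l \<rho> Amax by auto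
  moreover have "stabilizes Amax \<rho>0 \<rho>1 max_weight (l0 + \<epsilon>, l1 + \<epsilon>)"
    using \<epsilon> l \<rho> by (intro stabilizes_max_weight) auto
  ultimately show "(l0, l1) \<in> achievable_rate_region Amax \<rho>0 \<rho>1"
    using l \<epsilon>(1) is_policy_max_weight by (auto simp: achievable_rate_region_def)
qed

theorem lemma1:
  fixes \<rho>0 \<rho>1 :: real and Amax :: nat
  assumes "0 \<le> \<rho>0" "\<rho>0 \<le> 1" "0 \<le> \<rho>1" "\<rho>1 \<le> 1" "1 \<le> Amax"
  shows "achievable_rate_region Amax \<rho>0 \<rho>1 =
    (if \<rho>1 < 1 / 2
     then {(l0, l1). 0 \<le> l0 \<and> 0 \<le> l1 \<and> l1 < \<rho>1 \<and> l0 + l1 < \<rho>0 + \<rho>1 * (1 - \<rho>0)}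
     else {(l0, l1). 0 \<le> l0 \<and> 0 \<le> l1 \<and>
            ((l1 < (1 - \<rho>0) * (2 * \<rho>1 - 1) \<and> 2 * l0 + l1 < 1 + \<rho>0) \<or>
             ((1 - \<rho>0) * (2 * \<rho>1 - 1) \<le> l1 \<and> l1 < \<rho>1 \<and> l0 + l1 < \<rho>0 + (1 - \<rho>0) * \<rho>1))})"
proof -
  \<comment> \<open>\<open>c\<close> is the value of \<open>l1\<close> at which the lines
    \<open>l0 + l1 = S\<close> and \<open>2 * l0 + l1 = 1 + \<rho>0\<close> cross: below it the
    second constraint implies the first, from it on the converse holds.\<close>
  define S c where "S = \<rho>0 + \<rho>1 * (1 - \<rho>0)" and "c = (1 - \<rho>0) * (2 * \<rho>1 - 1)"
  have S_c: "2 * S = 1 + \<rho>0 + c"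
    by (simp add: S_def c_def algebra_simps)
  have S_commute: "\<rho>0 + (1 - \<rho>0) * \<rho>1 = S"
    by (simp add: S_def)
  have region: "achievable_rate_region Amax \<rho>0 \<rho>1 =
      {(l0, l1). 0 \<le> l0 \<and> 0 \<le> l1 \<and> l1 < \<rho>1 \<and> l0 + l1 < S \<and> 2 * l0 + l1 < 1 + \<rho>0}"
    unfolding S_def by (rule achievable_rate_region_eq[OF assms])
  show ?thesis
  proof (cases "\<rho>1 < 1 / 2")
    case True
    then have "c \<le> 0"
      using assms by (auto simp: c_def intro: mult_nonneg_nonpos)
    then have "2 * l0 + l1 < 1 + \<rho>0" if "0 \<le> l1" "l0 + l1 < S" for l0 l1
      using that S_c by linarith
    then show ?thesis
      using True unfolding region S_def[symmetric] by auto
  next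
    case False
    \<comment> \<open>This expression equals \<open>\<rho>1 - c\<close>, so \<open>l1 < c\<close>
      already implies \<open>l1 < \<rho>1\<close>.\<close>
    have "0 \<le> (1 - \<rho>0) * (1 - \<rho>1) + \<rho>0 * \<rho>1" using assms by simp
    then have "c \<le> \<rho>1" by (simp add: c_def algebra_simps)
    then have "l1 < \<rho>1 \<and> l0 + l1 < S \<and> 2 * l0 + l1 < 1 + \<rho>0 \<longleftrightarrow>
        l1 < c \<and> 2 * l0 + l1 < 1 + \<rho>0 \<or> c \<le> l1 \<and> l1 < \<rho>1 \<and> l0 + l1 < S" for l0 l1
      using S_c by (cases "l1 < c") auto
    then show ?thesis
      using False unfolding region c_def[symmetric] S_commute by simp
  qed
qed

end
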